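(* Let $\varphi_e(z)=e^z$ and $\varphi_{1/2}(z)=\dfrac{1}{1-z}$ for $z\in\mathbb D$. Then $$R_{\mathcal S^*(\varphi_{1/2})}(\mathcal S^*(\varphi_e))=\log2.$$
   Context: Let $\mathbb D=\{z\in\mathbb C:|z|<1\}$ and let $\mathcal A$ be the class of functions $f$ analytic on $\mathbb D$ with $f(0)=0$ and $f'(0)=1$. For an analytic function $\varphi$ on $\mathbb D$ with $\varphi(0)=1$, the class $\mathcal S^*(\varphi)$ consists of all $f\in\mathcal A$ with $zf'(z)/f(z)\prec\varphi(z)$; that is, there is an analytic $\omega:\mathbb D\to\mathbb D$ with $\omega(0)=0$ such that $zf'(z)/f(z)=\varphi(\omega(z))$ on $\mathbb D$ (the quotient takes the value $1$ at $z=0$, and $f$ has no other zeros). For two such functions $\varphi_1,\varphi_2$, the sharp $\mathcal S^*(\varphi_2)$-radius of $\mathcal S^*(\varphi_1)$ is $$R_{\mathcal S^*(\varphi_2)}(\mathcal S^*(\varphi_1))=\sup\left\{r\in(0,1]: f_r(z)=\tfrac{f(rz)}{r}\text{ belongs to }\mathcal S^*(\varphi_2)\text{ for every } f\in\mathcal S^*(\varphi_1)\right\}.$$ *)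

theory Defs
  imports "HOL-Complex_Analysis.Complex_Analysis"
begin

abbreviation unit_disc :: "complex set" where
  "unit_disc \<equiv> ball 0 1"

(* Functions on the disc are rendered as total functions complex => complex; only
   their values on the disc matter in everything below. *)

definition normalized_analytic :: "(complex \<Rightarrow> complex) set" where
  "normalized_analytic =
     {f. f holomorphic_on unit_disc \<and> f 0 = 0 \<and> deriv f 0 = 1}"

definition subordinate :: "(complex \<Rightarrow> complex) \<Rightarrow> (complex \<Rightarrow> complex) \<Rightarrow> bool" where
  "subordinate g h \<longleftrightarrow>
     (\<exists>\<omega>. \<omega> holomorphic_on unit_disc \<and> \<omega> ` unit_disc \<subseteq> unit_disc \<and> \<omega> 0 = 0 \<and>
          (\<forall>z\<in>unit_disc. g z = h (\<omega> z)))"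

(* z f'(z) / f(z), with its removable singularity at the simple zero of f at 0 filled in. *)
definition log_deriv_quotient :: "(complex \<Rightarrow> complex) \<Rightarrow> complex \<Rightarrow> complex" where
  "log_deriv_quotient f z = (if z = 0 then 1 else z * deriv f z / f z)"

(* The absence of further zeros is required explicitly because x / 0 = 0 in HOL, so the
   subordination alone need not exclude them. *)
definition starlike_class :: "(complex \<Rightarrow> complex) \<Rightarrow> (complex \<Rightarrow> complex) set" where
  "starlike_class \<phi> =
     {f \<in> normalized_analytic.
        (\<forall>z\<in>unit_disc - {0}. f z \<noteq> 0) \<and> subordinate (log_deriv_quotient f) \<phi>}"

definition rescale :: "real \<Rightarrow> (complex \<Rightarrow> complex) \<Rightarrow> complex \<Rightarrow> complex" where
  "rescale r f z = f (of_real r * z) / of_real r"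

(* The sharp S*(phi2)-radius of the class S*(phi1); the target class comes first, as in the
   notation R_{S*(phi2)}(S*(phi1)). *)
definition starlike_radius :: "(complex \<Rightarrow> complex) \<Rightarrow> (complex \<Rightarrow> complex) \<Rightarrow> real" where
  "starlike_radius \<phi>2 \<phi>1 =
     Sup {r. 0 < r \<and> r \<le> 1 \<and> (\<forall>f\<in>starlike_class \<phi>1. rescale r f \<in> starlike_class \<phi>2)}"

definition phi_e :: "complex \<Rightarrow> complex" where
  "phi_e z = exp z"

definition phi_half :: "complex \<Rightarrow> complex" where
  "phi_half z = 1 / (1 - z)"

end

(* Since Re w > 1/2 iff |1 - 1/w| < 1, membership in the target class amounts to the
   function 1 - exp (-omega (r z)) mapping the disc into itself.  By the Schwarz lemma
   |omega (r z)| < r, and |exp w - 1| <= exp |w| - 1 then gives the bound exp r - 1 <= 1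
   for r <= ln 2.  Conversely, the extremal function f with z f'/f = exp z on the disc has
   z f'/f = 1/2 at -ln 2, a boundary value of 1 / (1 - z) that is not attained inside the disc. *)

theory Submission
  imports Defs
begin

text \<open>Dropping the constant term of both exponential series leaves sums over
  \<open>Suc n\<close>, which compare term by term because the norm is submultiplicative.\<close>

lemma norm_exp_minus_one_le:
  fixes x :: "'a::{real_normed_algebra_1,banach}"
  shows "norm (exp x - 1) \<le> exp (norm x) - 1"
proof -
  let ?t = "\<lambda>n. inverse (fact (Suc n)) *\<^sub>R (x ^ Suc n)"
  let ?s = "\<lambda>n. inverse (fact (Suc n)) *\<^sub>R (norm x ^ Suc n)"
  have le: "norm (?t n) \<le> ?s n" for n
    using norm_power_ineq[of x "Suc n"] by (simp add: mult_left_mono del: power_Suc fact_Suc)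
  have s: "summable ?s"
    using summable_ignore_initial_segment[OF summable_exp_generic[of "norm x"], of 1] by simp
  have "norm (suminf ?t) \<le> suminf ?s"
    using le s by (intro norm_suminf_le)
  then show ?thesis
    by (simp only: exp_first_term[of x] exp_first_term[of "norm x"] add_diff_cancel_left')
qed

lemma of_real_mult_mem_unit_disc:
  assumes "0 < r" "r \<le> 1" "z \<in> unit_disc"
  shows "of_real r * z \<in> unit_disc"
proof -
  have "norm (of_real r * z) \<le> norm z"
    using assms mult_right_mono[of r 1 "norm z"] by (simp add: norm_mult)
  then show ?thesis
    using assms(3) by simp
qed

lemma holomorphic_on_unit_disc_dilate:
  assumes "f holomorphic_on unit_disc" "0 < r" "r \<le> 1"
  shows "(\<lambda>z. f (of_real r * z)) holomorphic_on unit_disc"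
proof -
  have "(f \<circ> (\<lambda>z. of_real r * z)) holomorphic_on unit_disc"
    using assms of_real_mult_mem_unit_disc[OF assms(2,3)]
    by (intro holomorphic_on_compose_gen[where t = unit_disc] holomorphic_intros image_subsetI)
  then show ?thesis
    by (simp add: o_def)
qed

text \<open>By the chain rule the inner factor r cancels the division by r, so the derivative at z
  is just f' at rz; the remaining 1/r in the denominator turns z into rz. Where f vanishes at rz,
  both quotients are 0 by convention.\<close>

lemma log_deriv_quotient_rescale:
  assumes "f holomorphic_on unit_disc" "0 < r" "r \<le> 1" "z \<in> unit_disc"
  shows "log_deriv_quotient (rescale r f) z = log_deriv_quotient f (of_real r * z)"
proof -
  have "(f has_field_derivative deriv f (of_real r * z)) (at (of_real r * z))"
    using assms by (intro holomorphic_derivI[of _ unit_disc] of_real_mult_mem_unit_disc) auto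
  then have "(rescale r f has_field_derivative deriv f (of_real r * z)) (at z)"
    unfolding rescale_def[abs_def] using assms(2)
    by (auto intro!: derivative_eq_intros DERIV_chain2[of f])
  then have "deriv (rescale r f) z = deriv f (of_real r * z)"
    by (rule DERIV_imp_deriv)
  then show ?thesis
    using assms(2) by (simp add: log_deriv_quotient_def rescale_def)
qed

lemma rescale_normalized_analytic:
  assumes "f \<in> normalized_analytic" "0 < r" "r \<le> 1"
  shows "rescale r f \<in> normalized_analytic"
proof -
  have f: "f holomorphic_on unit_disc" "f 0 = 0" "deriv f 0 = 1"
    using assms(1) by (auto simp: normalized_analytic_def)
  have "rescale r f holomorphic_on unit_disc"
    unfolding rescale_def[abs_def] using assms(2)
    by (intro holomorphic_intros holomorphic_on_unit_disc_dilate f(1) assms(2,3)) auto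
  moreover have "(rescale r f has_field_derivative 1) (at 0)"
  proof -
    \<comment> \<open>The point 0 is written as \<open>of_real r * 0\<close> to match the inner map
      of the chain rule.\<close>
    have "(f has_field_derivative 1) (at (of_real r * 0))"
      using holomorphic_derivI[OF f(1), of 0] f(3) by simp
    then show ?thesis
      unfolding rescale_def[abs_def] using assms(2)
      by (auto intro!: derivative_eq_intros DERIV_chain2[of f])
  qed
  ultimately show ?thesis
    using f(2) by (auto simp: normalized_analytic_def rescale_def DERIV_imp_deriv)
qed

text \<open>The equation says that log (f z / z) has derivative (\<phi> z - 1) / z. This is
  holomorphic once the singularity at 0 is removed, hence has a primitive on the convex disc;
  exponentiating it also makes f z / z zero-free.\<close>

lemma exists_with_log_deriv_quotient:
  assumes "\<phi> holomorphic_on unit_disc" "\<phi> 0 = 1"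
  obtains f where "f \<in> normalized_analytic" "\<And>z. z \<in> unit_disc - {0} \<Longrightarrow> f z \<noteq> 0"
    "\<And>z. z \<in> unit_disc \<Longrightarrow> log_deriv_quotient f z = \<phi> z"
proof -
  define h where "h z = (if z = 0 then deriv \<phi> 0 else (\<phi> z - 1) / z)" for z
  have "h holomorphic_on unit_disc"
    \<comment> \<open>Since \<phi> 0 = 1, the principal part of \<phi> z / z at 0 is 1 / z;
      subtracting it leaves \<open>h\<close>.\<close>
    using pole_theorem_open[OF assms(1) open_ball, of 0 "\<lambda>z. \<phi> z / z"]
    by (rule holomorphic_transform) (auto simp: h_def assms(2) diff_divide_distrib)
  then obtain H where H: "\<And>z. z \<in> unit_disc \<Longrightarrow> (H has_field_derivative h z) (at z within unit_disc)"
    using holomorphic_convex_primitive'[OF convex_ball open_ball] by blast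
  \<comment> \<open>Subtracting \<open>H 0\<close> fixes the constant of integration so that f'(0) =
    1.\<close>
  define f where "f z = z * exp (H z - H 0)" for z
  have f': "(f has_field_derivative exp (H z - H 0) * \<phi> z) (at z)" if "z \<in> unit_disc" for z
  proof -
    have "(H has_field_derivative h z) (at z)"
      using H[OF that] that by (simp add: at_within_open[OF _ open_ball])
    then have "(f has_field_derivative exp (H z - H 0) * (1 + z * h z)) (at z)"
      unfolding f_def[abs_def] by (auto intro!: derivative_eq_intros simp: algebra_simps)
    moreover have "1 + z * h z = \<phi> z"
      by (simp add: h_def assms(2))
    ultimately show ?thesis by simp
  qed
  have d: "deriv f z = exp (H z - H 0) * \<phi> z" if "z \<in> unit_disc" for z
    using f'[OF that] by (rule DERIV_imp_deriv)
  show thesis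
  proof
    have "f holomorphic_on unit_disc"
      using f' unfolding holomorphic_on_open[OF open_ball] by blast
    then show "f \<in> normalized_analytic"
      using d[of 0] by (simp add: normalized_analytic_def f_def assms(2))
    show "f z \<noteq> 0" if "z \<in> unit_disc - {0}" for z
      using that by (simp add: f_def)
    show "log_deriv_quotient f z = \<phi> z" if "z \<in> unit_disc" for z
      using d[OF that] by (simp add: log_deriv_quotient_def f_def assms(2))
  qed
qed

lemma rescale_starlike_phi_half:
  assumes "f \<in> starlike_class phi_e" "0 < r" "r \<le> ln 2"
  shows "rescale r f \<in> starlike_class phi_half"
proof -
  have r1: "r \<le> 1"
    using assms(3) ln_2_less_1 by simp
  have na: "f \<in> normalized_analytic" and nz: "\<And>z. z \<in> unit_disc - {0} \<Longrightarrow> f z \<noteq> 0"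
    using assms(1) by (auto simp: starlike_class_def)
  then have holf: "f holomorphic_on unit_disc"
    by (simp add: normalized_analytic_def)
  obtain \<omega> where \<omega>: "\<omega> holomorphic_on unit_disc" "\<omega> ` unit_disc \<subseteq> unit_disc" "\<omega> 0 = 0"
      "\<And>z. z \<in> unit_disc \<Longrightarrow> log_deriv_quotient f z = exp (\<omega> z)"
    using assms(1) by (auto simp: starlike_class_def subordinate_def phi_e_def)
  have norm_rz: "norm (of_real r * z) < r" if "z \<in> unit_disc" for z :: complex
    using that assms(2) by (simp add: norm_mult)
  have rz: "of_real r * z \<in> unit_disc" if "z \<in> unit_disc" for z
    using assms(2) r1 that by (rule of_real_mult_mem_unit_disc)
  \<comment> \<open>This is the unique solution of 1 / (1 - \<psi> z) = exp (\<omega> (r z)), hence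
    the only possible subordinating function.\<close>
  define \<psi> where "\<psi> z = 1 - exp (- \<omega> (of_real r * z))" for z
  have "\<psi> holomorphic_on unit_disc"
    unfolding \<psi>_def[abs_def]
    by (intro holomorphic_intros holomorphic_on_unit_disc_dilate \<omega>(1) assms(2) r1)
  moreover have "\<psi> ` unit_disc \<subseteq> unit_disc"
  proof clarify
    fix z :: complex assume z: "z \<in> unit_disc"
    have "norm (\<omega> (of_real r * z)) \<le> norm (of_real r * z)"
      using \<omega>(2) rz[OF z] by (intro Schwarz_Lemma(1)[OF \<omega>(1,3)]) (force simp: image_subset_iff)+
    \<comment> \<open>Strictness comes from |z| < 1, not from r, so r = ln 2 itself is
      covered.\<close>
    also have "\<dots> < ln 2"
      using norm_rz[OF z] assms(3) by simp
    finally have "exp (norm (\<omega> (of_real r * z))) < 2"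
      using exp_less_cancel_iff[of _ "ln 2 :: real"] by simp
    with norm_exp_minus_one_le[of "- \<omega> (of_real r * z)"] show "\<psi> z \<in> unit_disc"
      by (simp add: \<psi>_def norm_minus_commute)
  qed
  moreover have "\<psi> 0 = 0"
    by (simp add: \<psi>_def \<omega>(3))
  moreover have "log_deriv_quotient (rescale r f) z = phi_half (\<psi> z)" if "z \<in> unit_disc" for z
    using log_deriv_quotient_rescale[OF holf assms(2) r1 that] \<omega>(4)[OF rz[OF that]]
    by (simp add: phi_half_def \<psi>_def exp_minus divide_inverse)
  ultimately have "subordinate (log_deriv_quotient (rescale r f)) phi_half"
    unfolding subordinate_def by blast
  moreover have "rescale r f z \<noteq> 0" if "z \<in> unit_disc - {0}" for z
    using nz[of "of_real r * z"] rz[of z] that assms(2) by (simp add: rescale_def)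
  ultimately show ?thesis
    using rescale_normalized_analytic[OF na assms(2) r1] by (auto simp: starlike_class_def)
qed

text \<open>Shows that the value 1/2 cannot be reached from inside the open disc. At z = 1 the
  convention 1 / 0 = 0 keeps the equivalence true.\<close>

lemma phi_half_eq_half_iff: "phi_half z = 1 / 2 \<longleftrightarrow> z = -1"
  by (cases "z = 1") (auto simp: phi_half_def field_simps eq_neg_iff_add_eq_0)

lemma radius_le_ln2:
  assumes "0 < r" "r \<le> 1"
    and all: "\<And>f. f \<in> starlike_class phi_e \<Longrightarrow> rescale r f \<in> starlike_class phi_half"
  shows "r \<le> ln 2"
proof (rule ccontr)
  assume "\<not> r \<le> ln 2"
  then have r: "ln 2 < r" by simp
  obtain f where f: "f \<in> normalized_analytic" "\<And>z. z \<in> unit_disc - {0} \<Longrightarrow> f z \<noteq> 0"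
      "\<And>z. z \<in> unit_disc \<Longrightarrow> log_deriv_quotient f z = exp z"
    using exists_with_log_deriv_quotient[of exp] by (auto intro: holomorphic_intros)
  have "subordinate (log_deriv_quotient f) phi_e"
    unfolding subordinate_def phi_e_def
    by (rule exI[of _ "\<lambda>z. z"]) (auto simp: f(3))
  with f have "f \<in> starlike_class phi_e"
    by (simp add: starlike_class_def)
  from all[OF this] obtain \<omega> where \<omega>: "\<omega> ` unit_disc \<subseteq> unit_disc"
      "\<And>z. z \<in> unit_disc \<Longrightarrow> log_deriv_quotient (rescale r f) z = phi_half (\<omega> z)"
    by (auto simp: starlike_class_def subordinate_def)
  \<comment> \<open>Chosen so that rz = -ln 2, where the extremal quotient is exp (-ln 2) = 1/2; the
    assumption ln 2 < r is what puts z in the open disc.\<close>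
  define z :: complex where "z = of_real (- ln 2 / r)"
  have z: "z \<in> unit_disc"
    using r assms(1) by (simp add: z_def norm_divide del: of_real_minus of_real_divide)
  have rz: "of_real r * z = of_real (- ln 2)"
    using assms(1) by (simp add: z_def)
  have "phi_half (\<omega> z) = log_deriv_quotient f (of_real (- ln 2))"
    using \<omega>(2)[OF z] log_deriv_quotient_rescale[OF _ assms(1,2) z] f(1) rz
    by (simp add: normalized_analytic_def)
  also have "\<dots> = exp (of_real (- ln 2))"
    using ln_2_less_1 by (intro f(3)) (simp del: of_real_minus)
  also have "\<dots> = of_real (exp (- ln 2))"
    by (rule exp_of_real)
  also have "\<dots> = 1 / 2"
    by (simp add: exp_minus)
  finally have "\<omega> z = -1"
    by (rule phi_half_eq_half_iff[THEN iffD1])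
  moreover have "\<omega> z \<in> unit_disc"
    using \<omega>(1) z by blast
  ultimately show False by simp
qed

theorem theorem7p16:
  shows "starlike_radius phi_half phi_e = ln 2"
  unfolding starlike_radius_def
\<comment> \<open>A real \<open>Sup\<close> is meaningful only for nonempty sets bounded above;
  exhibiting ln 2 as a maximum settles both conditions and the value at once.\<close>
proof (rule cSup_eq_maximum)
  show "ln 2 \<in> {r. 0 < r \<and> r \<le> 1 \<and>
      (\<forall>f\<in>starlike_class phi_e. rescale r f \<in> starlike_class phi_half)}"
    using rescale_starlike_phi_half ln_2_less_1 by simp
qed (auto intro: radius_le_ln2)

end
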